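(* Let $K\ge 2$ and $T\ge 1$ be integers. Let $EB$ be the polyhedron of all pairs $(\widetilde X,\widetilde\delta)\in\mathbb{R}^{(K-1)\times T}\times\mathbb{R}^{K\times T}$ satisfying, for the indicated indices, $$\widetilde\delta_{1,t}=\widetilde X_{1,t},\qquad \widetilde\delta_{j,t}=\widetilde X_{j,t}-\widetilde X_{j-1,t}\ \ (j=2,\ldots,K-1),\qquad \widetilde\delta_{K,t}=1-\widetilde X_{K-1,t}\qquad (t=1,\ldots,T),$$ $$\widetilde X_{j,t}\ge \widetilde X_{j,t+1}\qquad (j=1,\ldots,K-1,\ t=1,\ldots,T-1),$$ $$\widetilde X_{j+1,t}\ge \widetilde X_{j,t}\qquad (j=1,\ldots,K-2,\ t=1,\ldots,T),$$ together with the bounds $0\le \widetilde X_{j,t}\le 1$ for $j=1,\ldots,K-1$, $t=1,\ldots,T$, and $0\le\widetilde\delta_{j,t}\le 1$ for $j=1,\ldots,K$, $t=1,\ldots,T$. Then the projection of $EB$ onto the space of the $\widetilde\delta$ variables, i.e. the polytope $\{\widetilde\delta\in\mathbb{R}^{K\times T}:\ \exists\,\widetilde X \text{ with } (\widetilde X,\widetilde\delta)\in EB\}$, is integral.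
   Context: A polytope (bounded polyhedron) is called integral if all of its vertices are integer-valued. Here $T$ is the number of data points and $K$ the number of segments; $\widetilde X$ and $\widetilde \delta$ denote the continuous (LP-relaxed) versions of binary variables. *)

theory Defs
  imports "HOL-Analysis.Analysis" "HOL-Analysis.Finite_Function_Topology"
begin

text \<open>
  Real arrays of varying size live in the real vector space of finitely supported functions on
  pairs of naturals. The subspace \<open>arrays m n\<close>, with row indices \<open>1..m\<close> and column
  indices \<open>1..n\<close>, is the copy of \<open>m \<times> n\<close> real matrices inside it.
\<close>

type_synonym array = "(nat \<times> nat) \<Rightarrow>\<^sub>0 real"

abbreviation entry :: "array \<Rightarrow> nat \<Rightarrow> nat \<Rightarrow> real"
  where "entry A j t \<equiv> Poly_Mapping.lookup A (j, t)"

definition arrays :: "nat \<Rightarrow> nat \<Rightarrow> array set"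
  where "arrays m n = {A. Poly_Mapping.keys A \<subseteq> {1..m} \<times> {1..n}}"

definition EB :: "nat \<Rightarrow> nat \<Rightarrow> (array \<times> array) set"
  where "EB K T = {(X, \<delta>).
     X \<in> arrays (K - 1) T \<and> \<delta> \<in> arrays K T \<and>
     (\<forall>t\<in>{1..T}. entry \<delta> 1 t = entry X 1 t) \<and>
     (\<forall>t\<in>{1..T}. \<forall>j\<in>{2..K - 1}. entry \<delta> j t = entry X j t - entry X (j - 1) t) \<and>
     (\<forall>t\<in>{1..T}. entry \<delta> K t = 1 - entry X (K - 1) t) \<and>
     (\<forall>j\<in>{1..K - 1}. \<forall>t\<in>{1..T - 1}. entry X j t \<ge> entry X j (t + 1)) \<and>
     (\<forall>j\<in>{1..K - 2}. \<forall>t\<in>{1..T}. entry X (j + 1) t \<ge> entry X j t) \<and>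
     (\<forall>j\<in>{1..K - 1}. \<forall>t\<in>{1..T}. 0 \<le> entry X j t \<and> entry X j t \<le> 1) \<and>
     (\<forall>j\<in>{1..K}. \<forall>t\<in>{1..T}. 0 \<le> entry \<delta> j t \<and> entry \<delta> j t \<le> 1)}"

text \<open>The vertices of a polytope are its extreme points.\<close>

definition integral_polytope :: "array set \<Rightarrow> bool"
  where "integral_polytope P \<longleftrightarrow>
     polytope P \<and> (\<forall>v. v extreme_point_of P \<longrightarrow> (\<forall>j t. entry v j t \<in> \<int>))"

end

theory Submission
  imports Defs
begin

text \<open>
  A point \<open>\<delta>\<close> of the projection is recovered from its partial column sums
  \<open>F j t = \<delta> 1 t + \<dots> + \<delta> j t\<close>, which are the \<open>X\<close> variables completed by a row \<open>0\<close> of zeros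
  and a row \<open>K\<close> of ones. In terms of \<open>F\<close> the system says that these two rows are as prescribed
  and that certain pairs of entries of \<open>F\<close> are ordered; the bounds on \<open>X\<close> and \<open>\<delta>\<close> follow. Such
  order relations survive thresholding: replacing each entry by the indicator of \<open>\<theta> \<le> F j t\<close>,
  for \<open>0 < \<theta> \<le> 1\<close>, gives again a feasible array, now with entries in \<open>{0, 1}\<close>
  (\<open>staircase_threshold\<close>).

  By the layer-cake formula, \<open>F\<close> is a convex combination of its thresholds at the finitely many
  positive values of \<open>F\<close>, the weight of each value being its gap to the next lower one
  (\<open>layer_cake_weights\<close>). Passing from \<open>F\<close> to \<open>\<delta>\<close> preserves convex combinations, so the
  projection is the convex hull of its finitely many points with entries in \<open>{-1, 0, 1}\<close>. A convex
  hull has no extreme points outside its generating set, so all vertices are integral.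
\<close>

section \<open>Cumulative coordinates\<close>

text \<open>
  The cumulative form of the system. The function \<open>F\<close> stands for \<open>X\<close> together with the constant
  rows \<open>0\<close> and \<open>K\<close>, so that the three equations defining \<open>\<delta>\<close> become the single difference
  \<open>F j t - F (j - 1) t\<close>, and the bounds on \<open>X\<close> become instances of monotonicity in \<open>j\<close>.
\<close>

definition staircase :: "nat \<Rightarrow> nat \<Rightarrow> (nat \<Rightarrow> nat \<Rightarrow> real) \<Rightarrow> bool"
  where "staircase K T F \<longleftrightarrow>
     (\<forall>t\<in>{1..T}. F 0 t = 0 \<and> F K t = 1) \<and>
     (\<forall>t\<in>{1..T}. \<forall>j<K. F j t \<le> F (Suc j) t) \<and>
     (\<forall>t\<in>{1..<T}. \<forall>j\<le>K. F j (Suc t) \<le> F j t)"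

definition restrict_array :: "nat \<Rightarrow> nat \<Rightarrow> (nat \<Rightarrow> nat \<Rightarrow> real) \<Rightarrow> array"
  where "restrict_array m n f =
     Abs_poly_mapping (\<lambda>(j, t). if j \<in> {1..m} \<and> t \<in> {1..n} then f j t else 0)"

definition increments :: "nat \<Rightarrow> nat \<Rightarrow> (nat \<Rightarrow> nat \<Rightarrow> real) \<Rightarrow> array"
  where "increments K T F = restrict_array K T (\<lambda>j t. F j t - F (j - 1) t)"

lemma entry_restrict_array:
  "entry (restrict_array m n f) j t = (if j \<in> {1..m} \<and> t \<in> {1..n} then f j t else 0)"
proof -
  have "finite {x. (case x of (j, t) \<Rightarrow> if j \<in> {1..m} \<and> t \<in> {1..n} then f j t else 0) \<noteq> 0}"
    by (rule finite_subset[of _ "{1..m} \<times> {1..n}"]) (auto split: if_splits)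
  then show ?thesis
    by (simp add: restrict_array_def)
qed

lemma entry_increments:
  "entry (increments K T F) j t =
     (if j \<in> {1..K} \<and> t \<in> {1..T} then F j t - F (j - 1) t else 0)"
  by (simp add: increments_def entry_restrict_array)

lemma array_eqI: "(\<And>j t. entry A j t = entry B j t) \<Longrightarrow> A = B"
  by (auto intro: poly_mapping_eqI)

lemma entry_scaleR: "entry (r *\<^sub>R A) j t = r * entry A j t"
proof -
  have "finite {i. r *\<^sub>R Poly_Mapping.lookup A i \<noteq> 0}"
    by (rule finite_subset[of _ "Poly_Mapping.keys A"]) (auto simp: in_keys_iff)
  then show ?thesis
    by (simp add: scaleR_poly_mapping_def)
qed

lemma mem_arrays_iff:
  "A \<in> arrays m n \<longleftrightarrow> (\<forall>j t. \<not> (j \<in> {1..m} \<and> t \<in> {1..n}) \<longrightarrow> entry A j t = 0)"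
  unfolding arrays_def mem_Collect_eq subset_iff split_paired_All mem_Times_iff fst_conv snd_conv
    in_keys_iff
  by blast

lemma restrict_array_in_arrays: "restrict_array m n f \<in> arrays m n"
  unfolding mem_arrays_iff entry_restrict_array by simp

lemma increments_in_arrays: "increments K T F \<in> arrays K T"
  by (simp add: increments_def restrict_array_in_arrays)

lemma staircase_mono:
  assumes "staircase K T F" "t \<in> {1..T}" "i \<le> j" "j \<le> K"
  shows "F i t \<le> F j t"
  using assms(3,4)
proof (induction j rule: dec_induct)
  case (step j)
  then have "F j t \<le> F (Suc j) t"
    using assms(1,2) by (auto simp: staircase_def)
  with step show ?case by simp
qed simp

lemma staircase_bounds:
  assumes "staircase K T F" "t \<in> {1..T}" "j \<le> K"
  shows "0 \<le> F j t" "F j t \<le> 1"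
  using staircase_mono[OF assms(1,2), of 0 j] staircase_mono[OF assms(1,2), of j K] assms
  by (auto simp: staircase_def)

lemma EB_imp_staircase:
  assumes "K \<ge> 2" "(X, \<delta>) \<in> EB K T"
  defines "F \<equiv> \<lambda>j t. if j = 0 then 0 else if j < K then entry X j t else 1"
  shows "staircase K T F" "\<delta> = increments K T F"
proof -
  have down: "\<And>j t. j \<in> {1..K - 1} \<Longrightarrow> t \<in> {1..T - 1} \<Longrightarrow> entry X j (t + 1) \<le> entry X j t"
    and up: "\<And>j t. j \<in> {1..K - 2} \<Longrightarrow> t \<in> {1..T} \<Longrightarrow> entry X j t \<le> entry X (j + 1) t"
    and bounds: "\<And>j t. j \<in> {1..K - 1} \<Longrightarrow> t \<in> {1..T} \<Longrightarrow> 0 \<le> entry X j t \<and> entry X j t \<le> 1"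
    and first: "\<And>t. t \<in> {1..T} \<Longrightarrow> entry \<delta> 1 t = entry X 1 t"
    and mid: "\<And>j t. j \<in> {2..K - 1} \<Longrightarrow> t \<in> {1..T} \<Longrightarrow>
                entry \<delta> j t = entry X j t - entry X (j - 1) t"
    and final: "\<And>t. t \<in> {1..T} \<Longrightarrow> entry \<delta> K t = 1 - entry X (K - 1) t"
    and supp: "\<delta> \<in> arrays K T"
    using assms(2) unfolding EB_def by blast+
  show "staircase K T F"
    unfolding staircase_def
  proof (intro conjI ballI allI impI)
    fix t j assume t: "t \<in> {1..T}" and j: "j < K"
    consider "j = 0" | "j \<in> {1..K - 2}" | "j = K - 1" "j \<noteq> 0"
      using j by fastforce
    then show "F j t \<le> F (Suc j) t"
    proof cases
      case 1
      then show ?thesis using bounds[of 1 t] t assms(1) by (simp add: F_def)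
    next
      case 2
      then show ?thesis using up[of j t] t assms(1) by (auto simp: F_def)
    next
      case 3
      then show ?thesis using bounds[of j t] t assms(1) by (auto simp: F_def)
    qed
  next
    fix t j assume "t \<in> {1..<T}" "j \<le> K"
    then show "F j (Suc t) \<le> F j t"
      using down[of j t] by (auto simp: F_def)
  qed (use assms(1) in \<open>auto simp: F_def\<close>)
  show "\<delta> = increments K T F"
  proof (rule array_eqI)
    fix j t
    consider "\<not> (j \<in> {1..K} \<and> t \<in> {1..T})" | "j = 1" "t \<in> {1..T}"
      | "j \<in> {2..K - 1}" "t \<in> {1..T}" | "j = K" "t \<in> {1..T}"
      by fastforce
    then show "entry \<delta> j t = entry (increments K T F) j t"
    proof cases
      case 1
      then show ?thesis
        using supp unfolding mem_arrays_iff entry_increments by auto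
    next
      case 2
      then show ?thesis using first[of t] assms(1) by (simp add: entry_increments F_def)
    next
      case 3
      then show ?thesis using mid[of j t] assms(1) by (auto simp: entry_increments F_def)
    next
      case 4
      then show ?thesis using final[of t] assms(1) by (auto simp: entry_increments F_def)
    qed
  qed
qed

lemma staircase_imp_EB:
  assumes "K \<ge> 2" "staircase K T F"
  shows "(restrict_array (K - 1) T F, increments K T F) \<in> EB K T"
    (is "(?X, ?\<delta>) \<in> _")
proof -
  have ends: "\<And>t. t \<in> {1..T} \<Longrightarrow> F 0 t = 0" "\<And>t. t \<in> {1..T} \<Longrightarrow> F K t = 1"
    and up: "\<And>j t. t \<in> {1..T} \<Longrightarrow> j < K \<Longrightarrow> F j t \<le> F (Suc j) t"
    and down: "\<And>j t. t \<in> {1..<T} \<Longrightarrow> j \<le> K \<Longrightarrow> F j (Suc t) \<le> F j t"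
    using assms(2) unfolding staircase_def by blast+
  have bounds: "\<And>j t. t \<in> {1..T} \<Longrightarrow> j \<le> K \<Longrightarrow> 0 \<le> F j t \<and> F j t \<le> 1"
    using staircase_bounds[OF assms(2)] by blast
  have incr: "0 \<le> F j t - F (j - 1) t \<and> F j t - F (j - 1) t \<le> 1"
    if "t \<in> {1..T}" "j \<in> {1..K}" for j t
    using up[of t "j - 1"] bounds[of t j] bounds[of t "j - 1"] that by force
  show ?thesis
    unfolding EB_def mem_Collect_eq prod.case
  proof (intro conjI ballI)
    show "?X \<in> arrays (K - 1) T" "?\<delta> \<in> arrays K T"
      by (rule restrict_array_in_arrays increments_in_arrays)+
  next
    fix j t assume "j \<in> {1..K - 1}" "t \<in> {1..T - 1}"
    then show "entry ?X j (t + 1) \<le> entry ?X j t"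
      using down[of t j] by (auto simp: entry_restrict_array)
  next
    fix j t assume "j \<in> {1..K - 2}" "t \<in> {1..T}"
    then show "entry ?X j t \<le> entry ?X (j + 1) t"
      using up[of t j] by (auto simp: entry_restrict_array)
  next
    fix t j assume "t \<in> {1..T}" "j \<in> {2..K - 1}"
    then show "entry ?\<delta> j t = entry ?X j t - entry ?X (j - 1) t"
      by (auto simp: entry_increments entry_restrict_array)
  qed (use assms(1) ends bounds incr in
      \<open>auto simp: entry_increments entry_restrict_array\<close>)
qed

lemma projection_eq_increments:
  assumes "K \<ge> 2"
  shows "{\<delta> \<in> arrays K T. \<exists>X. (X, \<delta>) \<in> EB K T} = increments K T ` {F. staircase K T F}"
  using EB_imp_staircase[OF assms] staircase_imp_EB[OF assms] increments_in_arrays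
  by blast

text \<open>
  The staircases form a convex set and \<open>increments\<close> is linear in the array, so the image is convex.
  This gives the inclusion of the hull of the integral points in the projection.
\<close>

lemma convex_increments: "convex (increments K T ` {F. staircase K T F})"
proof (rule convexI, elim imageE CollectE)
  fix \<delta> \<delta>' F G and u v :: real
  assume uv: "0 \<le> u" "0 \<le> v" "u + v = 1"
    and F: "\<delta> = increments K T F" "staircase K T F"
    and G: "\<delta>' = increments K T G" "staircase K T G"
  let ?H = "\<lambda>j t. u * F j t + v * G j t"
  have "staircase K T ?H"
    using F(2) G(2) uv unfolding staircase_def
    by (auto intro!: add_mono mult_left_mono)
  moreover have "u *\<^sub>R \<delta> + v *\<^sub>R \<delta>' = increments K T ?H"
    by (rule array_eqI)
      (simp add: F G lookup_add entry_scaleR entry_increments algebra_simps)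
  ultimately show "u *\<^sub>R \<delta> + v *\<^sub>R \<delta>' \<in> increments K T ` {F. staircase K T F}"
    by blast
qed

section \<open>Layer-cake decomposition\<close>

text \<open>
  The weight of a value is its gap to the next lower value, or to \<open>0\<close>. Adding a new largest
  value leaves the earlier weights alone, whence the induction.
\<close>

lemma layer_cake_weights:
  fixes S :: "real set"
  assumes "finite S" "\<forall>s\<in>S. 0 < s"
  shows "\<exists>w. (\<forall>s\<in>S. 0 \<le> w s) \<and> (\<forall>x\<in>insert 0 S. (\<Sum>s\<in>S. w s * of_bool (s \<le> x)) = x)"
  using assms
proof (induction S rule: finite_linorder_max_induct)
  case (insert b A)
  have "\<forall>s\<in>A. 0 < s"
    using insert.prems by blast
  then obtain w where w: "\<forall>s\<in>A. 0 \<le> w s"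
    and sums: "\<And>x. x \<in> insert 0 A \<Longrightarrow> (\<Sum>s\<in>A. w s * of_bool (s \<le> x)) = x"
    using insert.IH by blast
  define m where "m = Max (insert 0 A)"
  have m: "m \<in> insert 0 A" "\<And>s. s \<in> insert 0 A \<Longrightarrow> s \<le> m"
    using insert.hyps(1) Max_in[of "insert 0 A"] Max_ge[of "insert 0 A"] by (auto simp: m_def)
  have b: "b \<notin> A" "0 < b" "m < b"
    using insert.hyps insert.prems m(1) by auto
  let ?w = "w(b := b - m)"
  have split: "(\<Sum>s\<in>insert b A. ?w s * of_bool (s \<le> x)) =
      (b - m) * of_bool (b \<le> x) + (\<Sum>s\<in>A. w s * of_bool (s \<le> x))" for x
    using insert.hyps(1) b(1) by (auto intro!: sum.cong)
  \<comment> \<open>Every value in \<open>A\<close> lies below both \<open>b\<close> and \<open>m\<close>, so the two thresholds select the same terms.\<close>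
  have "(\<Sum>s\<in>A. w s * of_bool (s \<le> b)) = (\<Sum>s\<in>A. w s * of_bool (s \<le> m))"
    using m(2) b(3) by (force intro!: sum.cong)
  then have "(\<Sum>s\<in>insert b A. ?w s * of_bool (s \<le> b)) = b"
    using split[of b] sums[OF m(1)] by simp
  moreover have "(\<Sum>s\<in>insert b A. ?w s * of_bool (s \<le> x)) = x" if "x \<in> insert 0 A" for x
    using split[of x] sums[OF that] m(2)[OF that] b(3) by simp
  moreover have "\<forall>s\<in>insert b A. 0 \<le> ?w s"
    using w b by auto
  ultimately show ?case by blast
qed simp

text \<open>The bounds on \<open>\<theta>\<close> keep row \<open>0\<close> at \<open>0\<close> and row \<open>K\<close> at \<open>1\<close>.\<close>

lemma staircase_threshold:
  assumes "staircase K T F" "0 < \<theta>" "\<theta> \<le> 1"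
  shows "staircase K T (\<lambda>j t. of_bool (\<theta> \<le> F j t))"
  using assms unfolding staircase_def by (auto simp: of_bool_def intro: order_trans)

text \<open>
  Differences of two indicators lie in \<open>{-1, 0, 1}\<close>, and any finite set of integers serves for
  finiteness and integrality of the generating set.
\<close>

definition sign_arrays :: "nat \<Rightarrow> nat \<Rightarrow> array set"
  where "sign_arrays K T = {\<delta> \<in> arrays K T. \<forall>j t. entry \<delta> j t \<in> {-1, 0, 1}}"

lemma finite_sign_arrays: "finite (sign_arrays K T)"
proof (rule finite_imageD)
  let ?B = "{f. \<forall>x. (x \<in> {1..K} \<times> {1..T} \<longrightarrow> f x \<in> {-1, 0, 1 :: real}) \<and>
                    (x \<notin> {1..K} \<times> {1..T} \<longrightarrow> f x = 0)}"
  have "finite ?B"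
    by (intro finite_set_of_finite_funs) auto
  moreover have "Poly_Mapping.lookup ` sign_arrays K T \<subseteq> ?B"
    unfolding sign_arrays_def mem_arrays_iff by auto
  ultimately show "finite (Poly_Mapping.lookup ` sign_arrays K T)"
    by (rule finite_subset[rotated])
  show "inj_on Poly_Mapping.lookup (sign_arrays K T)"
    by (auto intro!: inj_onI poly_mapping_eqI)
qed

lemma threshold_increments_sign:
  "increments K T (\<lambda>j t. of_bool (\<theta> \<le> F j t)) \<in> sign_arrays K T"
  by (simp add: sign_arrays_def increments_in_arrays entry_increments)

text \<open>
  The levels are the positive values of \<open>F\<close> on the whole index range. Row \<open>K\<close> puts \<open>1\<close> among them,
  as their maximum, so the identity for the weights at \<open>x = 1\<close> says that the weights sum to \<open>1\<close>;
  at \<open>x = F j t\<close> it says that the weighted thresholds add up to \<open>F\<close>. A column must exist for the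
  value \<open>1\<close> to occur, whence \<open>T \<ge> 1\<close>.
\<close>

lemma increments_in_hull:
  assumes "T \<ge> 1" "staircase K T F"
  shows "increments K T F
           \<in> convex hull (increments K T ` {F. staircase K T F} \<inter> sign_arrays K T)"
    (is "_ \<in> convex hull ?V")
proof -
  define S where "S = {x \<in> (\<lambda>(j, t). F j t) ` ({0..K} \<times> {1..T}). 0 < x}"
  have fin: "finite S" and pos: "\<forall>s\<in>S. 0 < s"
    by (auto simp: S_def)
  have vals: "F j t \<in> insert 0 S" if "j \<le> K" "t \<in> {1..T}" for j t
    using staircase_bounds(1)[OF assms(2) that(2,1)] that by (force simp: S_def)
  have le1: "s \<le> 1" if "s \<in> S" for s
    using that staircase_bounds(2)[OF assms(2)] by (auto simp: S_def)
  obtain w where w: "\<And>s. s \<in> S \<Longrightarrow> 0 \<le> w s"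
    and sums: "\<And>x. x \<in> insert 0 S \<Longrightarrow> (\<Sum>s\<in>S. w s * of_bool (s \<le> x)) = x"
    using layer_cake_weights[OF fin pos] by blast
  have one: "1 \<in> S"
    using vals[of K 1] assms by (auto simp: staircase_def)
  have total: "(\<Sum>s\<in>S. w s) = 1"
    using sums[of 1] one le1 by simp
  let ?layer = "\<lambda>s. increments K T (\<lambda>j t. of_bool (s \<le> F j t))"
  have "(\<Sum>s\<in>S. w s *\<^sub>R ?layer s) \<in> convex hull ?V"
  proof (rule convex_sum[OF fin convex_convex_hull total w])
    fix s assume "s \<in> S"
    then show "?layer s \<in> convex hull ?V"
      using pos le1 staircase_threshold[OF assms(2)] threshold_increments_sign
      by (intro hull_inc) blast
  qed
  moreover have "increments K T F = (\<Sum>s\<in>S. w s *\<^sub>R ?layer s)"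
  proof (rule array_eqI)
    fix j t
    show "entry (increments K T F) j t = entry (\<Sum>s\<in>S. w s *\<^sub>R ?layer s) j t"
    proof (cases "j \<in> {1..K} \<and> t \<in> {1..T}")
      case True
      then have "j \<le> K" "j - 1 \<le> K" "t \<in> {1..T}"
        by auto
      then have "F j t - F (j - 1) t =
          (\<Sum>s\<in>S. w s * of_bool (s \<le> F j t)) - (\<Sum>s\<in>S. w s * of_bool (s \<le> F (j - 1) t))"
        using sums[OF vals] by simp
      then show ?thesis
        using True
        by (simp add: lookup_sum entry_scaleR entry_increments sum_subtractf right_diff_distrib)
    qed (auto simp: lookup_sum entry_scaleR entry_increments intro!: sum.neutral)
  qed
  ultimately show ?thesis by simp
qed

lemma integral_polytope_if_convex_hull:
  assumes "finite V" "P = convex hull V" "\<And>v j t. v \<in> V \<Longrightarrow> entry v j t \<in> \<int>"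
  shows "integral_polytope P"
  using assms extreme_point_of_convex_hull[of _ V]
  unfolding integral_polytope_def polytope_def by blast

theorem corollary1:
  fixes K T :: nat
  assumes "K \<ge> 2" and "T \<ge> 1"
  shows "integral_polytope {\<delta> \<in> arrays K T. \<exists>X. (X, \<delta>) \<in> EB K T}"
proof -
  let ?P = "increments K T ` {F. staircase K T F}"
  let ?V = "?P \<inter> sign_arrays K T"
  have hull: "?P = convex hull ?V"
  proof
    show "?P \<subseteq> convex hull ?V"
      using increments_in_hull[OF assms(2)] by blast
    show "convex hull ?V \<subseteq> ?P"
      by (intro hull_minimal convex_increments) blast
  qed
  have "finite ?V"
    using finite_sign_arrays by (rule finite_Int[OF disjI2])
  moreover have "entry v j t \<in> \<int>" if "v \<in> ?V" for v j t
  proof -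
    have "entry v j t \<in> {-1, 0, 1}"
      using that by (simp add: sign_arrays_def)
    then show ?thesis by auto
  qed
  ultimately have "integral_polytope ?P"
    by (rule integral_polytope_if_convex_hull[OF _ hull])
  then show ?thesis
    by (simp only: projection_eq_increments[OF assms(1)])
qed

end
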